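(* Let $A\in\mathbb{C}^{n\times n}$ and $u(A)=\inf_{U}\|UAU^*\|_{\rm max}$, the infimum over all $n\times n$ unitary matrices $U$. Then \[ \frac{\|A\|_{\rm F}}{n}\le u(A)\le\|A\|_2, \] and $\frac{\|A\|_{\rm F}}{n}=u(A)$ if and only if $A$ is $\mathcal U$-apportionable. If $A$ is normal, then $u(A)\le\frac{\|A\|_*}{n}$. All of these bounds are sharp (each of the three inequalities holds with equality for some matrix to which it applies).
   Context: $\|B\|_{\rm max}=\max_{k,j}|b_{kj}|$; $\|A\|_{\rm F}$ is the Frobenius norm; $\|A\|_2$ is the spectral norm (largest singular value); $\|A\|_*$ is the nuclear norm (sum of the $n$ singular values). A complex square matrix is uniform if all its entries have the same absolute value. $A$ is $\mathcal U$-apportionable if there is an $n\times n$ unitary $U$ such that $UAU^*$ is uniform. *)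

theory Defs
  imports
    Complex_Main
    "HOL-Computational_Algebra.Polynomial"
    "Jordan_Normal_Form.Schur_Decomposition"
begin

definition max_norm :: "complex mat \<Rightarrow> real" where
  "max_norm B = Max {cmod (B $$ (k, j)) | k j. k < dim_row B \<and> j < dim_col B}"

definition frobenius_norm :: "complex mat \<Rightarrow> real" where
  "frobenius_norm A = sqrt (\<Sum>i<dim_row A. \<Sum>j<dim_col A. (cmod (A $$ (i, j)))\<^sup>2)"

(* Square roots of the eigenvalues of A^* A, counted with algebraic multiplicity.
   For A of size n x n this multiset has n elements.  The matrix A^* A is positive
   semidefinite, so its eigenvalues are nonnegative reals and Re only changes the type. *)
definition singular_values :: "complex mat \<Rightarrow> real multiset" where
  "singular_values A =
     image_mset (\<lambda>z. sqrt (Re z)) (proots (char_poly (mat_adjoint A * A)))"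

definition spectral_norm :: "complex mat \<Rightarrow> real" where
  "spectral_norm A = Max (set_mset (singular_values A))"

definition nuclear_norm :: "complex mat \<Rightarrow> real" where
  "nuclear_norm A = sum_mset (singular_values A)"

definition unitary_mats :: "nat \<Rightarrow> complex mat set" where
  "unitary_mats n =
     {U \<in> carrier_mat n n. U * mat_adjoint U = 1\<^sub>m n \<and> mat_adjoint U * U = 1\<^sub>m n}"

definition normal_mat :: "complex mat \<Rightarrow> bool" where
  "normal_mat A \<longleftrightarrow> square_mat A \<and> A * mat_adjoint A = mat_adjoint A * A"

definition uniform_mat :: "complex mat \<Rightarrow> bool" where
  "uniform_mat A \<longleftrightarrow> square_mat A \<and>
     (\<forall>a \<in> elements_mat A. \<forall>b \<in> elements_mat A. cmod a = cmod b)"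

definition unitarily_apportionable :: "complex mat \<Rightarrow> bool" where
  "unitarily_apportionable A \<longleftrightarrow> square_mat A \<and>
     (\<exists>U \<in> unitary_mats (dim_row A). uniform_mat (U * A * mat_adjoint U))"

(* For a square matrix of positive size the infimum is over a nonempty set of
   nonnegative reals. *)
definition u_norm :: "complex mat \<Rightarrow> real" where
  "u_norm A = (INF U \<in> unitary_mats (dim_row A). max_norm (U * A * mat_adjoint U))"

end

theory Submission
  imports Defs
begin

text \<open>
  Unitary conjugation preserves the Frobenius norm, and an n-by-n matrix has Frobenius norm at most
  n times its max norm, with equality exactly for uniform matrices. Since the unitary group is
  compact, the infimum u(A) is attained, which turns the equality case for a single matrix into the
  equality case for u(A). For the upper bound, diagonalize A* A: its diagonal entries, the squared
  column norms of A, are convex combinations of its eigenvalues, so the entries of A itself are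
  bounded by the spectral norm. If A = V D V* is normal, conjugating D by the discrete Fourier
  matrix, all of whose entries have modulus 1 / sqrt n, gives entries of modulus at most
  (1/n) times the sum of the moduli of the eigenvalues, which are the singular values. The all-ones
  matrix attains the first bound, the identity matrix the other two.
\<close>

section \<open>Adjoints and unitary matrices\<close>

lemma dim_adjoint [simp]:
  "dim_row (mat_adjoint A) = dim_col A" "dim_col (mat_adjoint A) = dim_row A"
  by (simp_all add: mat_adjoint_def)

lemma adjoint_carrier [simp]:
  "A \<in> carrier_mat n m \<Longrightarrow> mat_adjoint A \<in> carrier_mat m n"
  by auto

lemma index_adjoint [simp]:
  fixes A :: "complex mat"
  assumes "i < dim_col A" "j < dim_row A"
  shows "mat_adjoint A $$ (i, j) = cnj (A $$ (j, i))"
  using assms by (simp add: mat_adjoint_def mat_of_rows_def)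

lemma adjoint_adjoint [simp]: "mat_adjoint (mat_adjoint A) = (A :: complex mat)"
  by (rule eq_matI) auto

lemma adjoint_one [simp]: "mat_adjoint (1\<^sub>m n :: complex mat) = 1\<^sub>m n"
  by (rule eq_matI) auto

lemma index_mult_square:
  assumes "A \<in> carrier_mat n n" "B \<in> carrier_mat n n" "i < n" "j < n"
  shows "(A * B) $$ (i, j) = (\<Sum>k<n. A $$ (i, k) * B $$ (k, j))"
  using assms by (auto simp: scalar_prod_def atLeast0LessThan intro!: sum.cong)

lemma index_mult_square3:
  assumes "A \<in> carrier_mat n n" "B \<in> carrier_mat n n" "C \<in> carrier_mat n n" "i < n" "j < n"
  shows "(A * B * C) $$ (i, j) = (\<Sum>l<n. (\<Sum>k<n. A $$ (i, k) * B $$ (k, l)) * C $$ (l, j))"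
  unfolding index_mult_square[OF mult_carrier_mat[OF assms(1,2)] assms(3-5)]
  by (intro sum.cong refl arg_cong2[of _ _ _ _ "(*)"] index_mult_square[OF assms(1,2,4)]) auto

lemma adjoint_mult:
  fixes A B :: "complex mat"
  assumes "A \<in> carrier_mat n n" "B \<in> carrier_mat n n"
  shows "mat_adjoint (A * B) = mat_adjoint B * mat_adjoint A"
  using assms
  by (intro eq_matI) (auto simp: scalar_prod_def mult.commute intro!: sum.cong)

lemma index_adjoint_mult_self:
  fixes A :: "complex mat"
  assumes "A \<in> carrier_mat n n" "j < n"
  shows "(mat_adjoint A * A) $$ (j, j) = of_real (\<Sum>i<n. (cmod (A $$ (i, j)))\<^sup>2)"
  using assms
  by (subst index_mult_square[of _ n])
    (auto simp: mult.commute simp flip: complex_norm_square intro!: sum.cong)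

lemma index_mult_adjoint_self:
  fixes A :: "complex mat"
  assumes "A \<in> carrier_mat n n" "i < n"
  shows "(A * mat_adjoint A) $$ (i, i) = of_real (\<Sum>j<n. (cmod (A $$ (i, j)))\<^sup>2)"
  using assms
  by (subst index_mult_square[of _ n])
    (auto simp flip: complex_norm_square intro!: sum.cong)

lemma unitary_matsD:
  assumes "U \<in> unitary_mats n"
  shows "U \<in> carrier_mat n n" "mat_adjoint U \<in> carrier_mat n n"
    "U * mat_adjoint U = 1\<^sub>m n" "mat_adjoint U * U = 1\<^sub>m n"
  using assms by (auto simp: unitary_mats_def)

text \<open>A one-sided inverse of a square matrix is two-sided, so one of the two identities
  suffices.\<close>

lemma unitary_matsI:
  assumes "U \<in> carrier_mat n n" "mat_adjoint U * U = 1\<^sub>m n"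
  shows "U \<in> unitary_mats n"
  using assms mat_mult_left_right_inverse[OF adjoint_carrier[OF assms(1)] assms(1,2)]
  by (simp add: unitary_mats_def)

lemma unitary_one [simp]: "1\<^sub>m n \<in> unitary_mats n"
  by (rule unitary_matsI) auto

lemma unitary_adjoint:
  assumes "U \<in> unitary_mats n"
  shows "mat_adjoint U \<in> unitary_mats n"
  using unitary_matsD[OF assms] by (simp add: unitary_mats_def)

lemma unitary_conj_carrier:
  assumes "U \<in> unitary_mats n" "A \<in> carrier_mat n n"
  shows "U * A * mat_adjoint U \<in> carrier_mat n n"
  using unitary_matsD[OF assms(1)] assms(2) by auto

lemma unitary_mats_nonempty: "unitary_mats n \<noteq> {}"
  using unitary_one by blast

text \<open>The first two equations have right-nested left-hand sides, so they fire as rewrite rules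
  once products are reassociated to the right.\<close>

lemma unitary_mult_cancel:
  assumes U: "U \<in> unitary_mats n" and X: "X \<in> carrier_mat n n"
  shows "U * (mat_adjoint U * X) = X" "mat_adjoint U * (U * X) = X"
    "(X * U) * mat_adjoint U = X" "(X * mat_adjoint U) * U = X"
  using unitary_matsD[OF U] X
  by (simp_all flip: assoc_mult_mat[of U n n _ n X n] assoc_mult_mat[of "mat_adjoint U" n n _ n X n]
    add: assoc_mult_mat[of X n n _ n _ n])

lemma unitary_mult:
  assumes U: "U \<in> unitary_mats n" and V: "V \<in> unitary_mats n"
  shows "U * V \<in> unitary_mats n"
proof (rule unitary_matsI)
  note Uc = unitary_matsD[OF U] and Vc = unitary_matsD[OF V]
  show "U * V \<in> carrier_mat n n"
    using Uc Vc by auto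
  have "mat_adjoint (U * V) * (U * V) = mat_adjoint V * (mat_adjoint U * (U * V))"
    using Uc Vc by (simp add: adjoint_mult[of U n V] assoc_mult_mat[of _ n n _ n _ n])
  also have "\<dots> = 1\<^sub>m n"
    using Uc Vc by (simp add: unitary_mult_cancel[OF U])
  finally show "mat_adjoint (U * V) * (U * V) = 1\<^sub>m n" .
qed

text \<open>Complete \<open>v\<close> to a basis, orthogonalize by Gram-Schmidt, which keeps the
  first vector, and then normalize the columns. The scalar \<open>c\<close> absorbs the
  normalization of \<open>v\<close>.\<close>

lemma exists_unitary_first_col:
  fixes v :: "complex vec"
  assumes v: "v \<in> carrier_vec n" and v0: "v \<noteq> 0\<^sub>v n"
  obtains W c where "W \<in> unitary_mats n" "col W 0 = c \<cdot>\<^sub>v v"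
proof -
  interpret cof_vec_space n "TYPE(complex)" .
  define b where "b = basis_completion v"
  define ws where "ws = gram_schmidt n b"
  define P where "P = mat_of_cols n ws"
  note b = basis_completion[OF v v0, folded b_def]
  have "n \<noteq> 0"
    using v v0 by auto
  then obtain vs where vs: "b = v # vs"
    using b by (cases b) auto
  have ws: "corthogonal ws" "set ws \<subseteq> carrier_vec n" "length ws = n"
    using gram_schmidt_result[OF b(2) _ _ ws_def] b by auto
  have hd: "ws ! 0 = v"
    using gram_schmidt_hd[OF v, of vs] ws(3) \<open>n \<noteq> 0\<close>
    unfolding ws_def vs by (metis hd_conv_nth list.size(3))
  have P: "P \<in> carrier_mat n n"
    unfolding P_def using mat_of_cols_carrier(1)[of n ws] ws(3) by simp
  have orth: "corthogonal_mat P"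
    using orthogonal_mat_of_cols ws unfolding P_def by blast
  \<comment> \<open>\<open>r j\<close> is the squared length of column \<open>j\<close>. The Gram
    matrix \<open>G\<close> is diagonal with these entries, by orthogonality of the columns.\<close>
  define r where "r j = (\<Sum>i<n. (cmod (P $$ (i, j)))\<^sup>2)" for j
  define G where "G = mat_adjoint P * P"
  have G: "G $$ (i, j) = (if i = j then of_real (r i) else 0)" if "i < n" "j < n" for i j
    using orth that P index_adjoint_mult_self[OF P, of i]
    by (auto simp: corthogonal_mat_def Let_def diagonal_mat_def G_def r_def)
  have r: "r i > 0" if "i < n" for i
  proof -
    have "G $$ (i, i) \<noteq> 0"
      using orth that P by (auto simp: corthogonal_mat_def Let_def G_def)
    moreover have "r i \<ge> 0"
      by (auto simp: r_def intro: sum_nonneg)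
    ultimately show ?thesis
      using G[OF that that] by auto
  qed
  \<comment> \<open>The columns of \<open>P\<close> are orthogonal but not of length 1 yet.\<close>
  define W where "W = mat n n (\<lambda>(i, j). P $$ (i, j) / sqrt (r j))"
  have W: "W \<in> carrier_mat n n"
    by (simp add: W_def)
  have "mat_adjoint W * W = 1\<^sub>m n"
  proof (rule eq_matI)
    fix i j
    assume "i < dim_row (1\<^sub>m n :: complex mat)" "j < dim_col (1\<^sub>m n :: complex mat)"
    then have ij: "i < n" "j < n"
      by auto
    have "(mat_adjoint W * W) $$ (i, j) = G $$ (i, j) / (sqrt (r i) * sqrt (r j))"
      unfolding G_def using ij P W
      by (subst (1 2) index_mult_square[of _ n])
        (auto simp: W_def sum_divide_distrib intro!: sum.cong)
    also have "\<dots> = (1\<^sub>m n :: complex mat) $$ (i, j)"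
      using ij G[OF ij] r[OF ij(1)]
      by (auto simp flip: of_real_mult)
    finally show "(mat_adjoint W * W) $$ (i, j) = (1\<^sub>m n :: complex mat) $$ (i, j)" .
  qed (use W in auto)
  then have "W \<in> unitary_mats n"
    using W by (rule unitary_matsI[rotated])
  moreover have "col W 0 = (1 / sqrt (r 0)) \<cdot>\<^sub>v v"
    using \<open>n \<noteq> 0\<close> ws v hd by (intro eq_vecI) (auto simp: W_def P_def mat_of_cols_def)
  ultimately show ?thesis
    using that by blast
qed

section \<open>Unitary triangularization and the spectral theorem\<close>

text \<open>Over the complex numbers the characteristic polynomial splits into \<open>n\<close>
  linear factors, and \<open>n > 0\<close> provides at least one of them.\<close>

lemma exists_eigenvector:
  fixes A :: "complex mat"
  assumes A: "A \<in> carrier_mat n n" and n: "n > 0"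
  obtains e v where "v \<in> carrier_vec n" "v \<noteq> 0\<^sub>v n" "A *\<^sub>v v = e \<cdot>\<^sub>v v"
proof -
  obtain es where es: "char_poly A = (\<Prod>a\<leftarrow>es. [:- a, 1:])" "length es = n"
    using char_poly_factorized[OF A] by auto
  then obtain e es' where "es = e # es'"
    using n by (cases es) auto
  then have "eigenvalue A e"
    unfolding eigenvalue_root_char_poly[OF A] es(1) by simp
  then show ?thesis
    using that A unfolding eigenvalue_def eigenvector_def by auto
qed

text \<open>Serves to lift the unitary matrix of the induction hypothesis by one dimension in the
  triangularization below.\<close>

lemma unitary_four_block:
  assumes V: "V \<in> unitary_mats n"
  shows "four_block_mat (1\<^sub>m 1) (0\<^sub>m 1 n) (0\<^sub>m n 1) V \<in> unitary_mats (Suc n)" (is "?X \<in> _")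
    and "mat_adjoint (four_block_mat (1\<^sub>m 1) (0\<^sub>m 1 n) (0\<^sub>m n 1) V) =
      four_block_mat (1\<^sub>m 1) (0\<^sub>m 1 n) (0\<^sub>m n 1) (mat_adjoint V)"
proof -
  note Vc = unitary_matsD[OF V]
  show adj: "mat_adjoint ?X = four_block_mat (1\<^sub>m 1) (0\<^sub>m 1 n) (0\<^sub>m n 1) (mat_adjoint V)"
    using Vc by (intro eq_matI) auto
  show "?X \<in> unitary_mats (Suc n)"
  proof (rule unitary_matsI)
    show "?X \<in> carrier_mat (Suc n) (Suc n)"
      using Vc by auto
    show "mat_adjoint ?X * ?X = 1\<^sub>m (Suc n)"
      unfolding adj using Vc
      by (subst mult_four_block_mat[of _ 1 1 _ n _ n _ _ 1 _ n]) auto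
  qed
qed

text \<open>Schur's theorem, by induction on the size: a unitary matrix whose first column is an
  eigenvector clears the first column below the diagonal, and the induction hypothesis handles the
  remaining block.\<close>

lemma unitary_triangularization:
  fixes A :: "complex mat"
  assumes "A \<in> carrier_mat n n"
  shows "\<exists>U \<in> unitary_mats n. \<exists>T \<in> carrier_mat n n.
    upper_triangular T \<and> A = U * T * mat_adjoint U"
  using assms
proof (induction n arbitrary: A)
  case 0
  then show ?case
    by (intro bexI[of _ "1\<^sub>m 0"] bexI[of _ A]) auto
next
  case (Suc n)
  note A = Suc.prems
  obtain e v where v: "v \<in> carrier_vec (Suc n)" "v \<noteq> 0\<^sub>v (Suc n)" "A *\<^sub>v v = e \<cdot>\<^sub>v v"
    using exists_eigenvector[OF A zero_less_Suc] by blast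
  obtain W c where W: "W \<in> unitary_mats (Suc n)" and col: "col W 0 = c \<cdot>\<^sub>v v"
    using exists_unitary_first_col[OF v(1,2)] by blast
  note Wc = unitary_matsD[OF W]
  define B where "B = mat_adjoint W * (A * W)"
  have B: "B \<in> carrier_mat (Suc n) (Suc n)"
    using Wc A by (auto simp: B_def)
  \<comment> \<open>Column 0 of \<open>W\<close> is an eigenvector of \<open>A\<close>, and
    \<open>mat_adjoint W\<close> sends it to the first unit vector; hence column 0 of
    \<open>B\<close> is \<open>e\<close> times that vector.\<close>
  have "col B 0 = mat_adjoint W *\<^sub>v (A *\<^sub>v col W 0)"
    unfolding B_def col_mult2[OF Wc(2) mult_carrier_mat[OF A Wc(1)] zero_less_Suc]
      col_mult2[OF A Wc(1) zero_less_Suc] ..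
  also have "A *\<^sub>v col W 0 = e \<cdot>\<^sub>v col W 0"
    unfolding col using A v
    by (simp add: mult_mat_vec[of A "Suc n" "Suc n"] smult_smult_assoc mult.commute)
  also have "mat_adjoint W *\<^sub>v (e \<cdot>\<^sub>v col W 0) = e \<cdot>\<^sub>v (mat_adjoint W *\<^sub>v col W 0)"
    using Wc v(1) by (intro mult_mat_vec[of _ "Suc n" "Suc n"]) (auto simp: col)
  also have "mat_adjoint W *\<^sub>v col W 0 = col (1\<^sub>m (Suc n)) 0"
    using Wc col_mult2[OF Wc(2,1), of 0] by simp
  finally have colB: "col B 0 = e \<cdot>\<^sub>v col (1\<^sub>m (Suc n)) 0" .
  have B0: "B $$ (Suc i, 0) = 0" if "i < n" for i
    using arg_cong[OF colB, of "\<lambda>w. w $ Suc i"] that B by auto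
  obtain B1 B2 B3 B4 where split: "split_block B 1 1 = (B1, B2, B3, B4)"
    by (cases "split_block B 1 1")
  have blocks: "B1 \<in> carrier_mat 1 1" "B2 \<in> carrier_mat 1 n" "B3 \<in> carrier_mat n 1"
    "B4 \<in> carrier_mat n n" "B = four_block_mat B1 B2 B3 B4"
    using split_block[OF split, of n n] B by auto
  have B3: "B3 = 0\<^sub>m n 1"
    using split B B0 by (intro eq_matI) (auto simp: split_block_def Let_def)
  obtain V T where V: "V \<in> unitary_mats n" and T: "T \<in> carrier_mat n n"
    "upper_triangular T" "B4 = V * T * mat_adjoint V"
    using Suc.IH[OF blocks(4)] by blast
  note Vc = unitary_matsD[OF V]
  define X where "X = four_block_mat (1\<^sub>m 1) (0\<^sub>m 1 n) (0\<^sub>m n 1) V"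
  \<comment> \<open>This is \<open>B\<close> conjugated by the adjoint of \<open>X\<close>: the row
    \<open>B2\<close> picks up a factor \<open>V\<close>, and \<open>B4\<close> turns into
    \<open>T\<close>.\<close>
  define T' where "T' = four_block_mat B1 (B2 * V) (0\<^sub>m n 1) T"
  have X: "X \<in> unitary_mats (Suc n)"
    and adjX: "mat_adjoint X = four_block_mat (1\<^sub>m 1) (0\<^sub>m 1 n) (0\<^sub>m n 1) (mat_adjoint V)"
    using unitary_four_block[OF V] by (simp_all add: X_def)
  note Xc = unitary_matsD[OF X]
  have T': "T' \<in> carrier_mat (Suc n) (Suc n)"
    using blocks T by (auto simp: T'_def)
  have "upper_triangular B1"
    using blocks by auto
  then have ut: "upper_triangular T'"
    unfolding T'_def using blocks T by (intro upper_triangular_four_block) auto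
  have "X * T' = four_block_mat B1 (B2 * V) (0\<^sub>m n 1) (V * T)"
    unfolding X_def T'_def using blocks T Vc
    by (subst mult_four_block_mat[of _ 1 1 _ n _ n _ _ 1 _ n]) auto
  also have "\<dots> * mat_adjoint X = four_block_mat B1 (B2 * V * mat_adjoint V) (0\<^sub>m n 1) B4"
    unfolding adjX T(3) using blocks T Vc
    by (subst mult_four_block_mat[of _ 1 1 _ n _ n _ _ 1 _ n]) auto
  also have "B2 * V * mat_adjoint V = B2"
    using blocks Vc by (simp add: assoc_mult_mat[of B2 1 n V n _ n])
  finally have XTX: "X * T' * mat_adjoint X = B"
    using blocks B3 by simp
  have "A = W * B * mat_adjoint W"
    using A Wc unfolding B_def
    by (simp add: unitary_mult_cancel[OF W])
  also have "\<dots> = (W * X) * T' * mat_adjoint (W * X)"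
    unfolding XTX[symmetric] using Wc Xc T'
    by (simp add: adjoint_mult[of W "Suc n" X] assoc_mult_mat[of _ "Suc n" "Suc n" _ "Suc n" _ "Suc n"]
      mult_carrier_mat[of _ "Suc n" "Suc n" _ "Suc n"])
  finally show ?case
    using ut T' unitary_mult[OF W X] by blast
qed

text \<open>Normality makes row \<open>i\<close> and column \<open>i\<close> equally long. If all
  earlier rows are diagonal, column \<open>i\<close> has only its diagonal entry, so nothing is left
  for the rest of row \<open>i\<close>.\<close>

lemma normal_upper_triangular_imp_diagonal:
  fixes T :: "complex mat"
  assumes T: "T \<in> carrier_mat n n" and ut: "upper_triangular T"
    and normal: "T * mat_adjoint T = mat_adjoint T * T"
  shows "diagonal_mat T"
proof -
  have "\<forall>j<n. i \<noteq> j \<longrightarrow> T $$ (i, j) = 0" if "i < n" for i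
    using that
  proof (induction i rule: less_induct)
    case (less i)
    have "(\<Sum>j<n. (cmod (T $$ (i, j)))\<^sup>2) = (\<Sum>j<n. (cmod (T $$ (j, i)))\<^sup>2)"
      using arg_cong[OF normal, of "\<lambda>M. M $$ (i, i)"]
      unfolding index_mult_adjoint_self[OF T less.prems] index_adjoint_mult_self[OF T less.prems]
        of_real_eq_iff .
    also have "(\<Sum>j<n. (cmod (T $$ (j, i)))\<^sup>2) = (\<Sum>j\<in>{i}. (cmod (T $$ (j, i)))\<^sup>2)"
    proof (rule sum.mono_neutral_right)
      show "\<forall>j\<in>{..<n} - {i}. (cmod (T $$ (j, i)))\<^sup>2 = 0"
      proof
        fix j
        assume "j \<in> {..<n} - {i}"
        \<comment> \<open>Above the diagonal the entry lies in an earlier row, which the induction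
          hypothesis covers; below it, triangularity applies.\<close>
        then consider "j < i" | "i < j" "j < n"
          by force
        then show "(cmod (T $$ (j, i)))\<^sup>2 = 0"
          using less upper_triangularD[OF ut] T by cases auto
      qed
    qed (use less.prems in auto)
    finally have "(\<Sum>j\<in>{..<n} - {i}. (cmod (T $$ (i, j)))\<^sup>2) = 0"
      using less.prems by (simp add: sum.remove[of _ i])
    then show ?case
      by (subst (asm) sum_nonneg_eq_0_iff) auto
  qed
  then show ?thesis
    using T by (auto simp: diagonal_mat_def)
qed

text \<open>Unitary conjugation preserves normality, so the triangular factor is normal and
  therefore diagonal.\<close>

lemma unitary_diagonalization:
  fixes A :: "complex mat"
  assumes A: "A \<in> carrier_mat n n" and normal: "A * mat_adjoint A = mat_adjoint A * A"
  obtains U D where "U \<in> unitary_mats n" "D \<in> carrier_mat n n" "diagonal_mat D"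
    "A = U * D * mat_adjoint U"
proof -
  obtain U T where U: "U \<in> unitary_mats n" and T: "T \<in> carrier_mat n n" "upper_triangular T"
    and AT: "A = U * T * mat_adjoint U"
    using unitary_triangularization[OF A] by blast
  note Uc = unitary_matsD[OF U]
  note assoc = assoc_mult_mat[of _ n n _ n _ n] mult_carrier_mat[of _ n n _ n]
  have T_eq: "T = mat_adjoint U * (A * U)"
    unfolding AT using Uc T by (simp add: assoc unitary_mult_cancel[OF U])
  have adjT: "mat_adjoint T = mat_adjoint U * (mat_adjoint A * U)"
    unfolding T_eq using Uc A by (simp add: adjoint_mult[of _ n] assoc)
  have "T * mat_adjoint T = mat_adjoint U * ((A * mat_adjoint A) * U)"
    unfolding adjT unfolding T_eq using Uc A by (simp add: assoc unitary_mult_cancel[OF U])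
  also have "\<dots> = mat_adjoint T * T"
    unfolding adjT normal unfolding T_eq using Uc A by (simp add: assoc unitary_mult_cancel[OF U])
  finally have "diagonal_mat T"
    by (intro normal_upper_triangular_imp_diagonal[OF T])
  then show ?thesis
    using that U T AT by blast
qed

lemma proots_prod_linear_factors: "proots (\<Prod>a\<leftarrow>xs. [:- a, 1 :: complex:]) = mset xs"
proof (induction xs)
  case (Cons a xs)
  have "(\<Prod>a\<leftarrow>xs. [:- a, 1:]) \<noteq> 0"
    by (auto simp: prod_list_zero_iff)
  then have "proots ([:- a, 1:] * (\<Prod>a\<leftarrow>xs. [:- a, 1:])) =
      proots [:- a, 1:] + proots (\<Prod>a\<leftarrow>xs. [:- a, 1:])"
    by (intro proots_mult) auto
  then show ?case
    unfolding Cons.IH by simp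
qed simp

text \<open>Similar matrices share the characteristic polynomial, and that of a diagonal matrix is
  visibly a product of linear factors.\<close>

lemma proots_char_poly_unitary_diagonal:
  fixes D :: "complex mat"
  assumes U: "U \<in> unitary_mats n" and D: "D \<in> carrier_mat n n" "diagonal_mat D"
  shows "proots (char_poly (U * D * mat_adjoint U)) = image_mset (\<lambda>i. D $$ (i, i)) (mset_set {..<n})"
proof -
  note Uc = unitary_matsD[OF U]
  have "similar_mat (U * D * mat_adjoint U) D"
    using Uc D by (intro similar_matI[of _ _ U "mat_adjoint U" n]) auto
  then have "char_poly (U * D * mat_adjoint U) = char_poly D"
    by (rule char_poly_similar)
  also have "\<dots> = (\<Prod>a\<leftarrow>diag_mat D. [:- a, 1:])"
    using D by (intro char_poly_upper_triangular[of _ n]) (auto simp: diagonal_mat_def)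
  also have "proots \<dots> = mset (diag_mat D)"
    by (rule proots_prod_linear_factors)
  also have "\<dots> = image_mset (\<lambda>i. D $$ (i, i)) (mset_set {..<n})"
    using D by (simp add: diag_mat_def atLeast0LessThan[symmetric] flip: mset_upt)
  finally show ?thesis .
qed

section \<open>Max norm, Frobenius norm and uniform matrices\<close>

text \<open>Positive size makes the set of moduli nonempty; on the empty set \<open>Max\<close>
  would be unspecified.\<close>

lemma max_norm_attained:
  assumes B: "B \<in> carrier_mat n n" and n: "n \<ge> 1"
  shows "\<exists>i<n. \<exists>j<n. max_norm B = cmod (B $$ (i, j))"
    and "i < n \<Longrightarrow> j < n \<Longrightarrow> cmod (B $$ (i, j)) \<le> max_norm B"
proof -
  define S where "S = {cmod (B $$ (k, j)) | k j. k < dim_row B \<and> j < dim_col B}"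
  have S: "S = (\<lambda>(k, j). cmod (B $$ (k, j))) ` ({..<n} \<times> {..<n})"
    using B by (auto simp: S_def)
  then have fin: "finite S" "S \<noteq> {}"
    using n by (auto simp: lessThan_empty_iff)
  have "Max S \<in> S"
    using fin by (rule Max_in)
  then show "\<exists>i<n. \<exists>j<n. max_norm B = cmod (B $$ (i, j))"
    unfolding max_norm_def S_def[symmetric] by (auto simp: S)
  show "cmod (B $$ (i, j)) \<le> max_norm B" if "i < n" "j < n"
    unfolding max_norm_def S_def[symmetric] using fin that by (intro Max_ge) (auto simp: S)
qed

lemma max_norm_le:
  assumes "B \<in> carrier_mat n n" "n \<ge> 1"
    and "\<And>i j. i < n \<Longrightarrow> j < n \<Longrightarrow> cmod (B $$ (i, j)) \<le> c"
  shows "max_norm B \<le> c"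
  using max_norm_attained(1)[OF assms(1,2)] assms(3) by auto

lemma max_norm_nonneg:
  assumes "B \<in> carrier_mat n n" "n \<ge> 1"
  shows "max_norm B \<ge> 0"
  using max_norm_attained(1)[OF assms] by auto

lemma frobenius_norm_square:
  assumes "A \<in> carrier_mat n n"
  shows "(frobenius_norm A)\<^sup>2 = (\<Sum>i<n. \<Sum>j<n. (cmod (A $$ (i, j)))\<^sup>2)"
  using assms by (simp add: frobenius_norm_def sum_nonneg)

lemma frobenius_norm_nonneg: "frobenius_norm A \<ge> 0"
  by (auto simp: frobenius_norm_def intro!: sum_nonneg)

text \<open>A common modulus can only be the largest one. This form matches the equality case of the
  comparison with the Frobenius norm.\<close>

lemma uniform_mat_max_norm:
  assumes B: "B \<in> carrier_mat n n" and n: "n \<ge> 1"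
  shows "uniform_mat B \<longleftrightarrow> (\<forall>i<n. \<forall>j<n. cmod (B $$ (i, j)) = max_norm B)"
proof
  assume "uniform_mat B"
  moreover obtain k l where "k < n" "l < n" "max_norm B = cmod (B $$ (k, l))"
    using max_norm_attained(1)[OF B n] by blast
  ultimately show "\<forall>i<n. \<forall>j<n. cmod (B $$ (i, j)) = max_norm B"
    using elements_matI[OF B] unfolding uniform_mat_def by metis
next
  assume "\<forall>i<n. \<forall>j<n. cmod (B $$ (i, j)) = max_norm B"
  then show "uniform_mat B"
    using B by (fastforce simp: uniform_mat_def dest!: elements_matD)
qed

text \<open>The squared Frobenius norm is a sum of \<open>n * n\<close> terms, each at most the
  squared max norm.\<close>

lemma frobenius_norm_le_max_norm:
  assumes B: "B \<in> carrier_mat n n" and n: "n \<ge> 1"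
  shows "frobenius_norm B / real n \<le> max_norm B"
    and "frobenius_norm B / real n = max_norm B \<longleftrightarrow> uniform_mat B"
proof -
  let ?m = "max_norm B"
  have m: "?m \<ge> 0"
    by (rule max_norm_nonneg[OF B n])
  have le: "(cmod (B $$ (i, j)))\<^sup>2 \<le> ?m\<^sup>2" if "i < n" "j < n" for i j
    using max_norm_attained(2)[OF B n that] by (simp add: power_mono)
  have frob: "(frobenius_norm B)\<^sup>2 = (\<Sum>(i, j)\<in>{..<n} \<times> {..<n}. (cmod (B $$ (i, j)))\<^sup>2)"
    unfolding frobenius_norm_square[OF B] by (simp add: sum.cartesian_product)
  have const: "(real n * ?m)\<^sup>2 = (\<Sum>(i, j)\<in>{..<n} \<times> {..<n}. ?m\<^sup>2)"
    by (simp add: card_cartesian_product power2_eq_square split_def)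
  have "(frobenius_norm B)\<^sup>2 \<le> (real n * ?m)\<^sup>2"
    unfolding frob const by (intro sum_mono) (auto intro: le)
  then have "frobenius_norm B \<le> real n * ?m"
    by (rule power2_le_imp_le) (use m in simp)
  then show "frobenius_norm B / real n \<le> ?m"
    using n by (simp add: field_simps)
  have "frobenius_norm B / real n = ?m \<longleftrightarrow> (frobenius_norm B)\<^sup>2 = (real n * ?m)\<^sup>2"
    using n m power2_eq_iff_nonneg[OF frobenius_norm_nonneg[of B], of "real n * ?m"]
    by (simp add: field_simps)
  \<comment> \<open>Equality means that the nonnegative gaps sum to zero, so that every single gap
    vanishes.\<close>
  also have "\<dots> \<longleftrightarrow> (\<Sum>(i, j)\<in>{..<n} \<times> {..<n}. ?m\<^sup>2 - (cmod (B $$ (i, j)))\<^sup>2) = 0"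
    unfolding frob const by (auto simp: sum_subtractf split_def)
  also have "\<dots> \<longleftrightarrow> (\<forall>i<n. \<forall>j<n. ?m\<^sup>2 - (cmod (B $$ (i, j)))\<^sup>2 = 0)"
    by (subst sum_nonneg_eq_0_iff) (use le in auto)
  also have "\<dots> \<longleftrightarrow> uniform_mat B"
  proof -
    have "?m\<^sup>2 - (cmod (B $$ (i, j)))\<^sup>2 = 0 \<longleftrightarrow> cmod (B $$ (i, j)) = ?m" for i j
      using m by (auto simp: power2_eq_iff_nonneg)
    then show ?thesis
      unfolding uniform_mat_max_norm[OF B n] by simp
  qed
  finally show "frobenius_norm B / real n = ?m \<longleftrightarrow> uniform_mat B" .
qed

text \<open>The squared Frobenius norm is the trace of either product with the adjoint. A unitary
  factor on the left preserves the first product and one on the right the second, hence the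
  disjunction.\<close>

lemma frobenius_norm_eqI:
  fixes A B :: "complex mat"
  assumes A: "A \<in> carrier_mat n n" and B: "B \<in> carrier_mat n n"
    and "mat_adjoint A * A = mat_adjoint B * B \<or> A * mat_adjoint A = B * mat_adjoint B"
  shows "frobenius_norm A = frobenius_norm B"
proof -
  have "(\<Sum>i<n. \<Sum>j<n. (cmod (A $$ (i, j)))\<^sup>2) = (\<Sum>i<n. \<Sum>j<n. (cmod (B $$ (i, j)))\<^sup>2)"
    using assms(3)
  proof
    assume eq: "mat_adjoint A * A = mat_adjoint B * B"
    have "(\<Sum>i<n. (cmod (A $$ (i, j)))\<^sup>2) = (\<Sum>i<n. (cmod (B $$ (i, j)))\<^sup>2)" if "j < n" for j
      using arg_cong[OF eq, of "\<lambda>M. M $$ (j, j)"]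
      unfolding index_adjoint_mult_self[OF A that] index_adjoint_mult_self[OF B that] of_real_eq_iff .
    then show ?thesis
      by (subst (1 2) sum.swap) auto
  next
    assume eq: "A * mat_adjoint A = B * mat_adjoint B"
    have "(\<Sum>j<n. (cmod (A $$ (i, j)))\<^sup>2) = (\<Sum>j<n. (cmod (B $$ (i, j)))\<^sup>2)" if "i < n" for i
      using arg_cong[OF eq, of "\<lambda>M. M $$ (i, i)"]
      unfolding index_mult_adjoint_self[OF A that] index_mult_adjoint_self[OF B that] of_real_eq_iff .
    then show ?thesis
      by auto
  qed
  then show ?thesis
    using A B by (simp add: frobenius_norm_def)
qed

lemma frobenius_norm_unitary:
  assumes A: "A \<in> carrier_mat n n" and U: "U \<in> unitary_mats n"
  shows "frobenius_norm (U * A * mat_adjoint U) = frobenius_norm A"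
proof -
  note Uc = unitary_matsD[OF U]
  note assoc = assoc_mult_mat[of _ n n _ n _ n] mult_carrier_mat[of _ n n _ n]
  have "frobenius_norm (U * A * mat_adjoint U) = frobenius_norm (U * A)"
    using A Uc
    by (intro frobenius_norm_eqI[of _ n] disjI2)
      (simp_all add: adjoint_mult[of _ n] assoc unitary_mult_cancel[OF U])
  also have "\<dots> = frobenius_norm A"
    using A Uc
    by (intro frobenius_norm_eqI[of _ n] disjI1)
      (simp_all add: adjoint_mult[of _ n] assoc unitary_mult_cancel[OF U])
  finally show ?thesis .
qed

section \<open>The infimum u(A) and its lower bound\<close>

lemma u_norm_le:
  assumes A: "A \<in> carrier_mat n n" and n: "n \<ge> 1" and U: "U \<in> unitary_mats n"
  shows "u_norm A \<le> max_norm (U * A * mat_adjoint U)"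
proof -
  \<comment> \<open>Without a lower bound for the set, its real infimum need not lie below its
    members.\<close>
  have "bdd_below ((\<lambda>U. max_norm (U * A * mat_adjoint U)) ` unitary_mats n)"
    by (intro bdd_belowI2[of _ 0] max_norm_nonneg[OF _ n] unitary_conj_carrier[OF _ A])
  then show ?thesis
    using A U by (auto simp: u_norm_def intro: cINF_lower)
qed

lemma u_norm_greatest:
  assumes "A \<in> carrier_mat n n"
    and "\<And>U. U \<in> unitary_mats n \<Longrightarrow> c \<le> max_norm (U * A * mat_adjoint U)"
  shows "c \<le> u_norm A"
  using assms unitary_mats_nonempty[of n] by (auto simp: u_norm_def intro!: cINF_greatest)

lemma frobenius_norm_le_u_norm:
  assumes A: "A \<in> carrier_mat n n" and n: "n \<ge> 1"
  shows "frobenius_norm A / real n \<le> u_norm A"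
proof (rule u_norm_greatest[OF A])
  fix U :: "complex mat"
  assume U: "U \<in> unitary_mats n"
  from frobenius_norm_le_max_norm(1)[OF unitary_conj_carrier[OF U A] n]
  show "frobenius_norm A / real n \<le> max_norm (U * A * mat_adjoint U)"
    unfolding frobenius_norm_unitary[OF A U] .
qed

section \<open>Compactness of the unitary group\<close>

text \<open>Bolzano-Weierstrass for finitely many coordinates at once. Each new coordinate is
  handled by a monotone subsequence of the subsequence found so far, and the earlier coordinates
  keep converging along it.\<close>

lemma bounded_imp_common_subsequence_real:
  fixes f :: "nat \<Rightarrow> 'a \<Rightarrow> real"
  assumes "finite S" and "\<And>k x. x \<in> S \<Longrightarrow> \<bar>f k x\<bar> \<le> c"
  shows "\<exists>r. strict_mono (r :: nat \<Rightarrow> nat) \<and> (\<forall>x\<in>S. convergent (\<lambda>k. f (r k) x))"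
  using assms
proof (induction S rule: finite_induct)
  case empty
  then show ?case
    using strict_mono_id by auto
next
  case (insert x S)
  then obtain r where r: "strict_mono r" "\<forall>x\<in>S. convergent (\<lambda>k. f (r k) x)"
    by auto
  obtain s :: "nat \<Rightarrow> nat" where s: "strict_mono s" "monoseq (\<lambda>k. f (r (s k)) x)"
    using seq_monosub[of "\<lambda>k. f (r k) x"] by (auto simp: comp_def)
  have "Bseq (\<lambda>k. f (r (s k)) x)"
    using insert.prems by (intro BseqI'[of _ c]) auto
  then have "convergent (\<lambda>k. f (r (s k)) x)"
    using s by (intro Bseq_monoseq_convergent)
  moreover have "convergent (\<lambda>k. f (r (s k)) y)" if "y \<in> S" for y
    using r(2) that convergent_subseq_convergent[of "\<lambda>k. f (r k) y" s] s(1) by (auto simp: comp_def)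
  ultimately show ?case
    using strict_mono_compose[OF r(1) s(1)] by (intro exI[of _ "\<lambda>k. r (s k)"]) auto
qed

lemma bounded_imp_common_subsequence_complex:
  fixes f :: "nat \<Rightarrow> 'a \<Rightarrow> complex"
  assumes S: "finite S" and bound: "\<And>k x. x \<in> S \<Longrightarrow> cmod (f k x) \<le> c"
  shows "\<exists>r. strict_mono (r :: nat \<Rightarrow> nat) \<and> (\<forall>x\<in>S. convergent (\<lambda>k. f (r k) x))"
proof -
  \<comment> \<open>Real and imaginary parts become separate real coordinates, told apart by a
    Boolean flag.\<close>
  define g where "g k p = (if snd p then Re (f k (fst p)) else Im (f k (fst p)))" for k p
  have "\<bar>g k p\<bar> \<le> c" if "p \<in> S \<times> UNIV" for k p
  proof -
    have "cmod (f k (fst p)) \<le> c"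
      using that by (intro bound) auto
    then show ?thesis
      using abs_Re_le_cmod[of "f k (fst p)"] abs_Im_le_cmod[of "f k (fst p)"] by (simp add: g_def)
  qed
  from bounded_imp_common_subsequence_real[of "S \<times> UNIV" g c, OF _ this]
  obtain r where r: "strict_mono (r :: nat \<Rightarrow> nat)"
    "\<And>p. p \<in> S \<times> UNIV \<Longrightarrow> convergent (\<lambda>k. g (r k) p)"
    using S by (auto simp del: mem_Times_iff)
  have "convergent (\<lambda>k. f (r k) x)" if x: "x \<in> S" for x
  proof -
    have "convergent (\<lambda>k. Re (f (r k) x))" "convergent (\<lambda>k. Im (f (r k) x))"
      using r(2)[of "(x, True)"] r(2)[of "(x, False)"] x by (simp_all add: g_def)
    then obtain a b where "(\<lambda>k. Re (f (r k) x)) \<longlonglongrightarrow> a" "(\<lambda>k. Im (f (r k) x)) \<longlonglongrightarrow> b"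
      by (auto simp: convergent_def)
    then have "(\<lambda>k. f (r k) x) \<longlonglongrightarrow> Complex a b"
      by (simp add: tendsto_complex_iff)
    then show ?thesis
      by (auto simp: convergent_def)
  qed
  then show ?thesis
    using r(1) by blast
qed

text \<open>Rows of a unitary matrix have length 1. This is the boundedness half of
  compactness.\<close>

lemma cmod_unitary_le_1:
  assumes U: "U \<in> unitary_mats n" and ij: "i < n" "j < n"
  shows "cmod (U $$ (i, j)) \<le> 1"
proof -
  note Uc = unitary_matsD[OF U]
  have "complex_of_real (\<Sum>j<n. (cmod (U $$ (i, j)))\<^sup>2) = of_real 1"
    using index_mult_adjoint_self[OF Uc(1) ij(1)] Uc(3) ij by simp
  then have "(\<Sum>j<n. (cmod (U $$ (i, j)))\<^sup>2) = 1"
    unfolding of_real_eq_iff .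
  moreover have "(cmod (U $$ (i, j)))\<^sup>2 \<le> (\<Sum>j<n. (cmod (U $$ (i, j)))\<^sup>2)"
    using ij by (intro member_le_sum) auto
  ultimately show ?thesis
    by (simp add: power2_le_imp_le)
qed

text \<open>Bounded entries converge along a common subsequence, and the unitarity equations survive
  the limit because they are polynomial in the entries and their conjugates.\<close>

lemma unitary_mats_seq_compact:
  assumes U: "\<And>k. U k \<in> unitary_mats n"
  shows "\<exists>r. strict_mono (r :: nat \<Rightarrow> nat) \<and> (\<exists>L\<in>unitary_mats n.
    \<forall>i<n. \<forall>j<n. (\<lambda>k. U (r k) $$ (i, j)) \<longlonglongrightarrow> L $$ (i, j))"
proof -
  obtain r where r: "strict_mono (r :: nat \<Rightarrow> nat)"
    "\<forall>x\<in>{..<n} \<times> {..<n}. convergent (\<lambda>k. U (r k) $$ x)"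
    using bounded_imp_common_subsequence_complex[of "{..<n} \<times> {..<n}" "\<lambda>k x. U k $$ x" 1]
      cmod_unitary_le_1[OF U] by auto
  define L where "L = mat n n (\<lambda>x. lim (\<lambda>k. U (r k) $$ x))"
  have lim: "(\<lambda>k. U (r k) $$ (i, j)) \<longlonglongrightarrow> L $$ (i, j)" if "i < n" "j < n" for i j
    using r(2) that by (simp add: L_def convergent_LIMSEQ_iff)
  have L: "L \<in> carrier_mat n n"
    by (simp add: L_def)
  note Uc = unitary_matsD[OF U]
  have "mat_adjoint L * L = 1\<^sub>m n"
  proof (rule eq_matI)
    fix i j
    assume "i < dim_row (1\<^sub>m n :: complex mat)" "j < dim_col (1\<^sub>m n :: complex mat)"
    then have ij: "i < n" "j < n"
      by auto
    have "(\<lambda>k. (mat_adjoint (U (r k)) * U (r k)) $$ (i, j)) \<longlonglongrightarrow> (mat_adjoint L * L) $$ (i, j)"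
      unfolding index_mult_square[OF Uc(2,1) ij] index_mult_square[OF adjoint_carrier[OF L] L ij]
      using ij L carrier_matD[OF Uc(1)]
      by (intro tendsto_sum tendsto_mult) (auto intro!: tendsto_cnj lim)
    then have "(\<lambda>k :: nat. (1\<^sub>m n :: complex mat) $$ (i, j)) \<longlonglongrightarrow> (mat_adjoint L * L) $$ (i, j)"
      unfolding Uc(4) .
    then show "(mat_adjoint L * L) $$ (i, j) = 1\<^sub>m n $$ (i, j)"
      using LIMSEQ_const_iff by metis
  qed (use L in auto)
  then show ?thesis
    using r(1) unitary_matsI[OF L] lim by blast
qed

text \<open>A minimizing sequence of unitary matrices has a subsequence converging entrywise to a
  unitary matrix, which is a minimizer.\<close>

lemma u_norm_attained:
  assumes A: "A \<in> carrier_mat n n" and n: "n \<ge> 1"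
  obtains U where "U \<in> unitary_mats n" "max_norm (U * A * mat_adjoint U) = u_norm A"
proof -
  define \<epsilon> where "\<epsilon> k = inverse (real (Suc k))" for k
  have "\<exists>U\<in>unitary_mats n. max_norm (U * A * mat_adjoint U) < u_norm A + \<epsilon> k" for k
  proof (rule ccontr)
    assume "\<not> ?thesis"
    then have "u_norm A + \<epsilon> k \<le> u_norm A"
      by (intro u_norm_greatest[OF A]) (auto simp: not_less)
    then show False
      by (simp add: \<epsilon>_def)
  qed
  then obtain U where U: "\<And>k. U k \<in> unitary_mats n"
    and close: "\<And>k. max_norm (U k * A * mat_adjoint (U k)) < u_norm A + \<epsilon> k"
    by metis
  obtain r L where r: "strict_mono (r :: nat \<Rightarrow> nat)" and L: "L \<in> unitary_mats n"
    and lim: "\<And>i j. i < n \<Longrightarrow> j < n \<Longrightarrow> (\<lambda>k. U (r k) $$ (i, j)) \<longlonglongrightarrow> L $$ (i, j)"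
    using unitary_mats_seq_compact[of U n, OF U] by blast
  note Uc = unitary_matsD[OF U] and Lc = unitary_matsD[OF L]
  \<comment> \<open>Only this direction needs the limit, and it is taken entry by entry; the
    converse is \<open>u_norm_le\<close>.\<close>
  have "max_norm (L * A * mat_adjoint L) \<le> u_norm A"
  proof (rule max_norm_le[OF _ n])
    show "L * A * mat_adjoint L \<in> carrier_mat n n"
      by (rule unitary_conj_carrier[OF L A])
    fix i j
    assume ij: "i < n" "j < n"
    have "(\<lambda>k. (U (r k) * A * mat_adjoint (U (r k))) $$ (i, j)) \<longlonglongrightarrow> (L * A * mat_adjoint L) $$ (i, j)"
      unfolding index_mult_square3[OF Uc(1) A Uc(2) ij] index_mult_square3[OF Lc(1) A Lc(2) ij]
      using ij carrier_matD[OF Lc(1)] carrier_matD[OF Uc(1)]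
      by (intro tendsto_sum tendsto_mult) (auto intro!: tendsto_cnj lim)
    then have "(\<lambda>k. cmod ((U (r k) * A * mat_adjoint (U (r k))) $$ (i, j)))
        \<longlonglongrightarrow> cmod ((L * A * mat_adjoint L) $$ (i, j))"
      by (rule tendsto_norm)
    moreover have "(\<lambda>k. u_norm A + \<epsilon> (r k)) \<longlonglongrightarrow> u_norm A + 0"
      unfolding \<epsilon>_def using LIMSEQ_subseq_LIMSEQ[OF LIMSEQ_inverse_real_of_nat r]
      by (intro tendsto_intros) (simp add: comp_def)
    moreover have "cmod ((U (r k) * A * mat_adjoint (U (r k))) $$ (i, j)) \<le> u_norm A + \<epsilon> (r k)" for k
      using max_norm_attained(2)[OF unitary_conj_carrier[OF U A] n ij, of "r k"] close[of "r k"]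
      by linarith
    ultimately show "cmod ((L * A * mat_adjoint L) $$ (i, j)) \<le> u_norm A"
      using LIMSEQ_le[of _ _ "\<lambda>k. u_norm A + \<epsilon> (r k)" "u_norm A + 0"] by auto
  qed
  then show ?thesis
    using that[OF L] u_norm_le[OF A n L] by simp
qed

text \<open>Equality forces a minimizer to be uniform, which is where attainment enters; conversely
  a uniform conjugate squeezes u(A) between two equal bounds.\<close>

lemma frobenius_norm_eq_u_norm_iff:
  assumes A: "A \<in> carrier_mat n n" and n: "n \<ge> 1"
  shows "frobenius_norm A / real n = u_norm A \<longleftrightarrow> unitarily_apportionable A"
proof -
  have uniform_iff: "uniform_mat (U * A * mat_adjoint U) \<longleftrightarrow>
      frobenius_norm A / real n = max_norm (U * A * mat_adjoint U)" if U: "U \<in> unitary_mats n" for U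
    using frobenius_norm_le_max_norm(2)[OF unitary_conj_carrier[OF U A] n]
    unfolding frobenius_norm_unitary[OF A U] by simp
  show ?thesis
  proof
    assume eq: "frobenius_norm A / real n = u_norm A"
    obtain U where "U \<in> unitary_mats n" "max_norm (U * A * mat_adjoint U) = u_norm A"
      using u_norm_attained[OF A n] by blast
    then show "unitarily_apportionable A"
      unfolding unitarily_apportionable_def using eq uniform_iff A by (metis carrier_matD square_mat.simps)
  next
    assume "unitarily_apportionable A"
    then obtain U where U: "U \<in> unitary_mats n" "uniform_mat (U * A * mat_adjoint U)"
      using A by (auto simp: unitarily_apportionable_def)
    then show "frobenius_norm A / real n = u_norm A"
      using uniform_iff[OF U(1)] u_norm_le[OF A n U(1)] frobenius_norm_le_u_norm[OF A n] by linarith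
  qed
qed

section \<open>Singular values and the upper bounds\<close>

lemma index_unitary_diagonal:
  fixes U D :: "complex mat"
  assumes U: "U \<in> carrier_mat n n" and D: "D \<in> carrier_mat n n" "diagonal_mat D"
    and ij: "i < n" "j < n"
  shows "(U * D * mat_adjoint U) $$ (i, j) = (\<Sum>k<n. U $$ (i, k) * D $$ (k, k) * cnj (U $$ (j, k)))"
proof -
  have "(\<Sum>k<n. U $$ (i, k) * D $$ (k, l)) = U $$ (i, l) * D $$ (l, l)" if l: "l < n" for l
  proof -
    have "(\<Sum>k<n. U $$ (i, k) * D $$ (k, l)) = (\<Sum>k\<in>{l}. U $$ (i, k) * D $$ (k, l))"
      using l D by (intro sum.mono_neutral_right) (auto simp: diagonal_mat_def)
    then show ?thesis
      by simp
  qed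
  then show ?thesis
    unfolding index_mult_square3[OF U D(1) adjoint_carrier[OF U] ij]
    using U ij by (intro sum.cong) auto
qed

lemma singular_values_unitary_diagonal:
  assumes "mat_adjoint A * A = U * D * mat_adjoint U"
    and "U \<in> unitary_mats n" "D \<in> carrier_mat n n" "diagonal_mat D"
  shows "singular_values A = image_mset (\<lambda>i. sqrt (Re (D $$ (i, i)))) (mset_set {..<n})"
  unfolding singular_values_def assms(1) proots_char_poly_unitary_diagonal[OF assms(2-4)]
  by (simp add: image_mset.compositionality comp_def)

lemma max_norm_le_spectral_norm:
  assumes A: "A \<in> carrier_mat n n" and n: "n \<ge> 1"
  shows "max_norm A \<le> spectral_norm A"
proof (rule max_norm_le[OF A n])
  fix i j
  assume ij: "i < n" "j < n"
  have A': "mat_adjoint A \<in> carrier_mat n n" and AA: "mat_adjoint A * A \<in> carrier_mat n n"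
    using A by auto
  obtain V D where V: "V \<in> unitary_mats n" and D: "D \<in> carrier_mat n n" "diagonal_mat D"
    and VD: "mat_adjoint A * A = V * D * mat_adjoint V"
    using unitary_diagonalization[OF AA] adjoint_mult[OF A' A] by auto
  note Vc = unitary_matsD[OF V]
  \<comment> \<open>\<open>m\<close> is the position of the largest eigenvalue of
    \<open>mat_adjoint A * A\<close>.\<close>
  obtain m where m: "m < n" "\<And>k. k < n \<Longrightarrow> Re (D $$ (k, k)) \<le> Re (D $$ (m, m))"
  proof -
    let ?S = "(\<lambda>k. Re (D $$ (k, k))) ` {..<n}"
    have "Max ?S \<in> ?S"
      using n by (intro Max_in) (auto simp: lessThan_empty_iff)
    then obtain m where "m < n" "Re (D $$ (m, m)) = Max ?S"
      by auto
    then show ?thesis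
      by (intro that[of m]) auto
  qed
  \<comment> \<open>These are the weights of the convex combination of eigenvalues.\<close>
  have row: "(\<Sum>k<n. (cmod (V $$ (j, k)))\<^sup>2) = 1"
    using arg_cong[OF Vc(3), of "\<lambda>M. M $$ (j, j)"] ij
    unfolding index_mult_adjoint_self[OF Vc(1) ij(2)]
    by (simp flip: of_real_power of_real_sum)
  have "(\<Sum>i<n. (cmod (A $$ (i, j)))\<^sup>2) = Re ((V * D * mat_adjoint V) $$ (j, j))"
    unfolding VD[symmetric] index_adjoint_mult_self[OF A ij(2)] by simp
  also have "\<dots> = (\<Sum>k<n. (cmod (V $$ (j, k)))\<^sup>2 * Re (D $$ (k, k)))"
    unfolding index_unitary_diagonal[OF Vc(1) D ij(2,2)] Re_sum
  proof (rule sum.cong)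
    fix k
    \<comment> \<open>The factor next to \<open>D $$ (k, k)\<close> is a real number, so taking the
      real part acts on the eigenvalue alone.\<close>
    have "V $$ (j, k) * D $$ (k, k) * cnj (V $$ (j, k)) =
        of_real ((cmod (V $$ (j, k)))\<^sup>2) * D $$ (k, k)"
      by (simp only: complex_norm_square mult_ac)
    then show "Re (V $$ (j, k) * D $$ (k, k) * cnj (V $$ (j, k))) =
        (cmod (V $$ (j, k)))\<^sup>2 * Re (D $$ (k, k))"
      by (simp only: Re_complex_of_real Im_complex_of_real times_complex.simps)
  qed simp
  also have "\<dots> \<le> (\<Sum>k<n. (cmod (V $$ (j, k)))\<^sup>2 * Re (D $$ (m, m)))"
    using m by (intro sum_mono mult_left_mono) auto
  also have "\<dots> = Re (D $$ (m, m))"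
    using row by (simp flip: sum_distrib_right)
  finally have "(\<Sum>i<n. (cmod (A $$ (i, j)))\<^sup>2) \<le> Re (D $$ (m, m))" .
  moreover have "(cmod (A $$ (i, j)))\<^sup>2 \<le> (\<Sum>i<n. (cmod (A $$ (i, j)))\<^sup>2)"
    using ij by (intro member_le_sum) auto
  ultimately have "cmod (A $$ (i, j)) \<le> sqrt (Re (D $$ (m, m)))"
    by (intro real_le_rsqrt) linarith
  also have "\<dots> \<le> spectral_norm A"
    unfolding spectral_norm_def singular_values_unitary_diagonal[OF VD V D]
    using m(1) by (intro Max_ge) auto
  finally show "cmod (A $$ (i, j)) \<le> spectral_norm A" .
qed

lemma u_norm_le_spectral_norm:
  assumes A: "A \<in> carrier_mat n n" and n: "n \<ge> 1"
  shows "u_norm A \<le> spectral_norm A"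
  using u_norm_le[OF A n unitary_one] max_norm_le_spectral_norm[OF A n] A by simp

section \<open>The discrete Fourier matrix and the nuclear norm bound\<close>

definition dft_mat :: "nat \<Rightarrow> complex mat" where
  "dft_mat n = mat n n (\<lambda>(i, j). cis (2 * pi * real j / real n) ^ i / sqrt (real n))"

text \<open>Column \<open>j\<close> lists the powers of the root of unity \<open>w j\<close>, so the
  inner product of two columns is a geometric sum in an \<open>n\<close>-th root of unity
  \<open>z\<close>. It vanishes unless \<open>z = 1\<close>, that is, unless the columns
  coincide.\<close>

lemma dft_mat_unitary:
  assumes n: "n \<ge> 1"
  shows "dft_mat n \<in> unitary_mats n"
proof (rule unitary_matsI)
  show F: "dft_mat n \<in> carrier_mat n n"
    by (simp add: dft_mat_def)
  define w where "w j = cis (2 * pi * real j / real n)" for j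
  have bij: "bij_betw w {..<n} {z. z ^ n = 1}"
    unfolding w_def using bij_betw_roots_unity[of n] n by simp
  have cnj_w: "cnj (w i) * w i = 1" for i
    by (simp add: w_def cis_cnj cis_mult)
  show "mat_adjoint (dft_mat n) * dft_mat n = 1\<^sub>m n"
  proof (rule eq_matI)
    fix i j
    assume "i < dim_row (1\<^sub>m n :: complex mat)" "j < dim_col (1\<^sub>m n :: complex mat)"
    then have ij: "i < n" "j < n"
      by auto
    define z where "z = cnj (w i) * w j"
    have "w i ^ n = 1" "w j ^ n = 1"
      using bij_betwE[OF bij] ij by auto
    then have zn: "z ^ n = 1"
      by (simp add: z_def power_mult_distrib flip: complex_cnj_power)
    have "(\<Sum>k<n. z ^ k) = (if i = j then of_nat n else 0)"
    proof (cases "i = j")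
      case True
      then show ?thesis
        by (simp add: z_def cnj_w)
    next
      case False
      have "z \<noteq> 1"
      proof
        assume "z = 1"
        then have "w i * z = w i"
          by simp
        moreover have "w i * z = w j * (cnj (w i) * w i)"
          by (simp add: z_def mult_ac)
        ultimately have "w i = w j"
          by (simp only: cnj_w mult_1_right)
        then show False
          using bij ij False by (auto simp: bij_betw_def dest: inj_onD)
      qed
      then show ?thesis
        using False zn by (simp add: geometric_sum)
    qed
    moreover have "(mat_adjoint (dft_mat n) * dft_mat n) $$ (i, j) = (\<Sum>k<n. z ^ k / of_nat n)"
      unfolding index_mult_square[OF adjoint_carrier[OF F] F ij]
    proof (rule sum.cong)
      fix k
      assume "k \<in> {..<n}"
      then have "mat_adjoint (dft_mat n) $$ (i, k) * dft_mat n $$ (k, j) =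
          z ^ k / of_real (sqrt (real n) * sqrt (real n))"
        using ij by (simp add: dft_mat_def z_def w_def power_mult_distrib del: real_sqrt_mult_self)
      then show "mat_adjoint (dft_mat n) $$ (i, k) * dft_mat n $$ (k, j) = z ^ k / of_nat n"
        by simp
    qed simp
    ultimately show "(mat_adjoint (dft_mat n) * dft_mat n) $$ (i, j) = 1\<^sub>m n $$ (i, j)"
      using ij n by (simp flip: sum_divide_distrib)
  qed (use F in auto)
qed

lemma cmod_dft_mat:
  assumes "i < n" "j < n"
  shows "cmod (dft_mat n $$ (i, j)) = 1 / sqrt (real n)"
  using assms by (simp add: dft_mat_def norm_divide norm_power)

lemma u_norm_le_nuclear_norm:
  assumes A: "A \<in> carrier_mat n n" and n: "n \<ge> 1" and normal: "normal_mat A"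
  shows "u_norm A \<le> nuclear_norm A / real n"
proof -
  obtain V D where V: "V \<in> unitary_mats n" and D: "D \<in> carrier_mat n n" "diagonal_mat D"
    and VD: "A = V * D * mat_adjoint V"
    using unitary_diagonalization[OF A] normal unfolding normal_mat_def by blast
  define F where "F = dft_mat n"
  have F: "F \<in> unitary_mats n"
    unfolding F_def by (rule dft_mat_unitary[OF n])
  note Vc = unitary_matsD[OF V] and Fc = unitary_matsD[OF F]
  note assoc = assoc_mult_mat[of _ n n _ n _ n] mult_carrier_mat[of _ n n _ n]
  have adjA: "mat_adjoint A = V * mat_adjoint D * mat_adjoint V"
    unfolding VD using Vc D by (simp add: adjoint_mult[of _ n] assoc)
  \<comment> \<open>The matrix \<open>V\<close> also diagonalizes \<open>mat_adjoint A * A\<close>,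
    with the squared moduli of the eigenvalues of \<open>A\<close> on the diagonal.\<close>
  have "mat_adjoint A * A = V * (mat_adjoint D * D) * mat_adjoint V"
    unfolding adjA unfolding VD using Vc D by (simp add: assoc unitary_mult_cancel[OF V])
  moreover have DD: "mat_adjoint D * D \<in> carrier_mat n n"
    using D by auto
  moreover have DD_index: "(mat_adjoint D * D) $$ (i, j) =
      (if i = j then of_real ((cmod (D $$ (i, i)))\<^sup>2) else 0)"
    if ij: "i < n" "j < n" for i j
  proof -
    have "(mat_adjoint D * D) $$ (i, j) = (\<Sum>k<n. cnj (D $$ (k, i)) * D $$ (k, j))"
      unfolding index_mult_square[OF adjoint_carrier[OF D(1)] D(1) ij]
      using D ij by (intro sum.cong) auto
    also have "\<dots> = (\<Sum>k\<in>{i}. cnj (D $$ (k, i)) * D $$ (k, j))"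
      using D ij by (intro sum.mono_neutral_right) (auto simp: diagonal_mat_def)
    finally show ?thesis
      using D ij by (auto simp: diagonal_mat_def mult.commute simp flip: complex_norm_square)
  qed
  moreover have "diagonal_mat (mat_adjoint D * D)"
    using DD DD_index D by (auto simp: diagonal_mat_def simp del: index_mult_mat(1))
  ultimately have "singular_values A =
      image_mset (\<lambda>i. sqrt (Re ((mat_adjoint D * D) $$ (i, i)))) (mset_set {..<n})"
    by (intro singular_values_unitary_diagonal[OF _ V])
  also have "\<dots> = image_mset (\<lambda>i. cmod (D $$ (i, i))) (mset_set {..<n})"
    by (intro image_mset_cong) (simp add: DD_index del: index_mult_mat(1) of_real_power)
  finally have nuclear: "nuclear_norm A = (\<Sum>k<n. cmod (D $$ (k, k)))"
    by (simp add: nuclear_norm_def sum_unfold_sum_mset)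
  \<comment> \<open>\<open>mat_adjoint V\<close> undoes the diagonalization and \<open>F\<close>
    then spreads the eigenvalues evenly.\<close>
  define U where "U = F * mat_adjoint V"
  have U: "U \<in> unitary_mats n"
    unfolding U_def by (intro unitary_mult F unitary_adjoint V)
  have UAU: "U * A * mat_adjoint U = F * D * mat_adjoint F"
    unfolding U_def VD using Vc Fc D by (simp add: adjoint_mult[of _ n] assoc unitary_mult_cancel[OF V])
  have "max_norm (F * D * mat_adjoint F) \<le> nuclear_norm A / real n"
  proof (rule max_norm_le[OF _ n])
    show "F * D * mat_adjoint F \<in> carrier_mat n n"
      by (rule unitary_conj_carrier[OF F D(1)])
    fix i j
    assume ij: "i < n" "j < n"
    have "cmod ((F * D * mat_adjoint F) $$ (i, j)) \<le>
        (\<Sum>k<n. cmod (F $$ (i, k) * D $$ (k, k) * cnj (F $$ (j, k))))"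
      unfolding index_unitary_diagonal[OF Fc(1) D ij] by (rule norm_sum)
    \<comment> \<open>Each of the two entries of \<open>F\<close> contributes a factor
      \<open>1 / sqrt (real n)\<close>.\<close>
    also have "\<dots> = (\<Sum>k<n. cmod (D $$ (k, k)) / real n)"
      using ij by (intro sum.cong) (auto simp: F_def norm_mult cmod_dft_mat)
    finally show "cmod ((F * D * mat_adjoint F) $$ (i, j)) \<le> nuclear_norm A / real n"
      by (simp add: nuclear sum_divide_distrib)
  qed
  then show ?thesis
    using u_norm_le[OF A n U] unfolding UAU by linarith
qed

section \<open>The identity matrix as an extremal example\<close>

lemma singular_values_one: "singular_values (1\<^sub>m n) = replicate_mset n 1"
proof -
  \<comment> \<open>A trivial diagonalization, with the identity in both roles.\<close>
  have "mat_adjoint (1\<^sub>m n :: complex mat) * 1\<^sub>m n = 1\<^sub>m n * 1\<^sub>m n * mat_adjoint (1\<^sub>m n)"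
    by simp
  from singular_values_unitary_diagonal[OF this unitary_one]
  have "singular_values (1\<^sub>m n) =
      image_mset (\<lambda>i. sqrt (Re ((1\<^sub>m n :: complex mat) $$ (i, i)))) (mset_set {..<n})"
    by (simp add: diagonal_mat_def)
  also have "\<dots> = image_mset (\<lambda>i. 1) (mset_set {..<n})"
    by (rule image_mset_cong) simp
  finally have "singular_values (1\<^sub>m n) = image_mset (\<lambda>i. 1) (mset_set {..<n})" .
  then show ?thesis
    by (simp add: image_mset_const_eq)
qed

text \<open>Every unitary conjugate of the identity is the identity, so the infimum is over a
  constant.\<close>

lemma u_norm_one:
  assumes "n \<ge> 1"
  shows "u_norm (1\<^sub>m n) = 1"
proof -
  have "max_norm (1\<^sub>m n :: complex mat) = 1"
  proof (rule antisym)
    show "max_norm (1\<^sub>m n :: complex mat) \<le> 1"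
      using assms by (intro max_norm_le[of _ n]) auto
    show "1 \<le> max_norm (1\<^sub>m n :: complex mat)"
      using max_norm_attained(2)[of "1\<^sub>m n :: complex mat" n 0 0] assms by simp
  qed
  then have "max_norm (U * 1\<^sub>m n * mat_adjoint U) = 1" if "U \<in> unitary_mats n" for U
    using unitary_matsD[OF that] by simp
  then show ?thesis
    by (simp add: u_norm_def unitary_mats_nonempty)
qed

text \<open>Sharpness is stated for nonzero matrices of every size, since the zero matrix attains
  all three bounds trivially.\<close>

theorem proposition4p4:
  fixes n :: nat
  assumes "n \<ge> 1"
  shows
    "(\<forall>A \<in> carrier_mat n n.
        frobenius_norm A / real n \<le> u_norm A \<and>
        u_norm A \<le> spectral_norm A \<and>
        (frobenius_norm A / real n = u_norm A \<longleftrightarrow> unitarily_apportionable A) \<and>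
        (normal_mat A \<longrightarrow> u_norm A \<le> nuclear_norm A / real n)) \<and>
     (\<exists>A \<in> carrier_mat n n. A \<noteq> 0\<^sub>m n n \<and> frobenius_norm A / real n = u_norm A) \<and>
     (\<exists>A \<in> carrier_mat n n. A \<noteq> 0\<^sub>m n n \<and> u_norm A = spectral_norm A) \<and>
     (\<exists>A \<in> carrier_mat n n. A \<noteq> 0\<^sub>m n n \<and> normal_mat A \<and> u_norm A = nuclear_norm A / real n)"
proof (intro conjI ballI impI)
  fix A :: "complex mat"
  assume A: "A \<in> carrier_mat n n"
  show "frobenius_norm A / real n \<le> u_norm A"
    by (rule frobenius_norm_le_u_norm[OF A assms])
  show "u_norm A \<le> spectral_norm A"
    by (rule u_norm_le_spectral_norm[OF A assms])
  show "frobenius_norm A / real n = u_norm A \<longleftrightarrow> unitarily_apportionable A"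
    by (rule frobenius_norm_eq_u_norm_iff[OF A assms])
  show "u_norm A \<le> nuclear_norm A / real n" if "normal_mat A"
    by (rule u_norm_le_nuclear_norm[OF A assms that])
next
  \<comment> \<open>The all-ones matrix is uniform already, so equality follows from the
    apportionability criterion with \<open>1\<^sub>m n\<close> as the unitary matrix.\<close>
  define J where "J = mat n n (\<lambda>_. 1 :: complex)"
  have J: "J \<in> carrier_mat n n"
    by (simp add: J_def)
  have "J $$ (0, 0) \<noteq> 0\<^sub>m n n $$ (0, 0)"
    using assms by (simp add: J_def)
  then have "J \<noteq> 0\<^sub>m n n"
    by auto
  moreover have "uniform_mat J"
    by (auto simp: uniform_mat_def J_def dest!: elements_matD)
  then have "unitarily_apportionable J"
    using J unfolding unitarily_apportionable_def
    by (intro conjI bexI[of _ "1\<^sub>m n"]) auto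
  ultimately show "\<exists>A \<in> carrier_mat n n. A \<noteq> 0\<^sub>m n n \<and> frobenius_norm A / real n = u_norm A"
    using frobenius_norm_eq_u_norm_iff[OF J assms] J by blast
next
  \<comment> \<open>The identity has u(A) and spectral norm 1 and nuclear norm \<open>n\<close>,
    which settles both remaining equalities.\<close>
  have "(1\<^sub>m n :: complex mat) $$ (0, 0) \<noteq> 0\<^sub>m n n $$ (0, 0)"
    using assms by simp
  then have nz: "(1\<^sub>m n :: complex mat) \<noteq> 0\<^sub>m n n"
    by metis
  show "\<exists>A \<in> carrier_mat n n. A \<noteq> 0\<^sub>m n n \<and> u_norm A = spectral_norm A"
    using assms nz
    by (intro bexI[of _ "1\<^sub>m n"]) (auto simp: u_norm_one spectral_norm_def singular_values_one)
  show "\<exists>A \<in> carrier_mat n n. A \<noteq> 0\<^sub>m n n \<and> normal_mat A \<and> u_norm A = nuclear_norm A / real n"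
    using assms nz
    by (intro bexI[of _ "1\<^sub>m n"])
      (auto simp: u_norm_one nuclear_norm_def singular_values_one normal_mat_def)
qed

end
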